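(* Let $C_R\ge1$ be an elliptic regularity constant, i.e. $\|D^2u\|_{L^2(\Omega)}\le C_R\left(\|\Delta u\|_{L^2(\Omega)}+\|u\|_{L^2(\Omega)}\right)$ for all $u\in V$. Assume that $C_R\,|\gamma\mathbb A-\mathbb I|_F<1$. Then there exist constants $C_V,C_{L^2}>0$ such that $$\operatorname{Re}a(u,u)\ \ge\ C_V\|u\|_V^2-C_{L^2}\|u\|_{L^2(\Omega)}^2\qquad\text{for all }u\in V.$$
   Context: $\Omega\subset\mathbb R^d$, $d\in\{2,3\}$, is a bounded Lipschitz domain that either has a smooth boundary or is a convex polygon (polyhedron); for $d=2$ and $\Gamma_D=\partial\Omega$ a polygonal $\Omega$ suffices. $\partial\Omega=\Gamma_D\cup\Gamma_R$ is a non-intersecting partition (either part may be empty). $\alpha>0$, $\beta\in\mathbb R$, $k>0$, $\theta>0$, and $\mathbf n\in\mathbb R^d$ is a constant unit vector. $\mathbb A:=\alpha\mathbb I+\beta\,\mathbf n\otimes\mathbf n\in\mathbb R^{d\times d}$ ($\mathbb I$ the identity matrix), $\mathbb A:\mathbb B=\operatorname{tr}(\mathbb A^\top\mathbb B)$, $|\cdot|_F$ is the Frobenius norm, $\gamma:=\operatorname{tr}\mathbb A/|\mathbb A|_F^2$, assumed $>0$. $D^2u$ is the Hessian. All function spaces are complex valued. $V:=\{v\in H^2(\Omega):v=0\text{ on }\Gamma_D\}$ with inner product $(u,v)_V:=\gamma^{-1}(\Delta u,\Delta v)_{L^2(\Omega)}+(u,v)_{H^1(\Omega)}$ and norm $\|u\|_V^2=(u,u)_V$,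 and $$a(u,v):=(\mathbb A:D^2u,\Delta v)_{L^2(\Omega)}+(\nabla u,\nabla v)_{L^2(\Omega)}-k^2(u,v)_{L^2(\Omega)}-i\theta(u,v)_{L^2(\Gamma_R)}.$$ *)

theory Defs
  imports "HOL-Analysis.Analysis"
begin

section \<open>Smooth functions and test functions\<close>

definition pderiv_at :: "'n::finite \<Rightarrow> (real^'n \<Rightarrow> 'b::real_normed_vector) \<Rightarrow> real^'n \<Rightarrow> 'b" where
  "pderiv_at i f x = frechet_derivative f (at x) (axis i 1)"

primrec iter_pderiv :: "'n::finite list \<Rightarrow> (real^'n \<Rightarrow> 'b::real_normed_vector) \<Rightarrow> real^'n \<Rightarrow> 'b" where
  "iter_pderiv [] f = f"
| "iter_pderiv (i # js) f = iter_pderiv js (pderiv_at i f)"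

definition smooth :: "(real^'n::finite \<Rightarrow> 'b::real_normed_vector) \<Rightarrow> bool" where
  "smooth f \<longleftrightarrow> (\<forall>js x. iter_pderiv js f differentiable (at x))"

definition test_function :: "(real^'n::finite) set \<Rightarrow> (real^'n \<Rightarrow> complex) \<Rightarrow> bool" where
  "test_function \<Omega> \<phi> \<longleftrightarrow>
     smooth \<phi> \<and> compact (closure {x. \<phi> x \<noteq> 0}) \<and> closure {x. \<phi> x \<noteq> 0} \<subseteq> \<Omega>"


section \<open>Square-integrable functions\<close>

definition in_L2 :: "'a measure \<Rightarrow> ('a \<Rightarrow> complex) \<Rightarrow> bool" where
  "in_L2 M f \<longleftrightarrow> f \<in> borel_measurable M \<and> integrable M (\<lambda>x. (norm (f x))\<^sup>2)"

definition l2_inner :: "'a measure \<Rightarrow> ('a \<Rightarrow> complex) \<Rightarrow> ('a \<Rightarrow> complex) \<Rightarrow> complex" where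
  "l2_inner M f g = (\<integral>x. f x * cnj (g x) \<partial>M)"

definition l2_inner_vec ::
  "'a measure \<Rightarrow> ('a \<Rightarrow> complex^'n::finite) \<Rightarrow> ('a \<Rightarrow> complex^'n) \<Rightarrow> complex" where
  "l2_inner_vec M F G = (\<Sum>i\<in>UNIV. l2_inner M (\<lambda>x. F x $ i) (\<lambda>x. G x $ i))"

text \<open>
  Used for scalar functions and for matrix-valued functions. The library norm on \<open>'a^'n^'n\<close> is the
  Frobenius norm.
\<close>

definition l2_norm :: "'a measure \<Rightarrow> ('a \<Rightarrow> 'b::real_normed_vector) \<Rightarrow> real" where
  "l2_norm M f = sqrt (\<integral>x. (norm (f x))\<^sup>2 \<partial>M)"


section \<open>Weak derivatives and Sobolev spaces\<close>

definition has_weak_pderiv ::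
  "(real^'n::finite) set \<Rightarrow> 'n \<Rightarrow> (real^'n \<Rightarrow> complex) \<Rightarrow> (real^'n \<Rightarrow> complex) \<Rightarrow> bool" where
  "has_weak_pderiv \<Omega> i u g \<longleftrightarrow> in_L2 (lebesgue_on \<Omega>) g \<and>
     (\<forall>\<phi>. test_function \<Omega> \<phi> \<longrightarrow>
        (\<integral>x. u x * pderiv_at i \<phi> x \<partial>lebesgue_on \<Omega>) = - (\<integral>x. g x * \<phi> x \<partial>lebesgue_on \<Omega>))"

text \<open>
  Elements of the Sobolev spaces are functions rather than classes of functions, and only their
  values on \<open>\<Omega>\<close> matter. The weak derivative is one representative of a class that is unique up to
  null sets; all notions below that use it are invariant under changes on null sets.
\<close>

definition weak_pderiv ::
  "(real^'n::finite) set \<Rightarrow> 'n \<Rightarrow> (real^'n \<Rightarrow> complex) \<Rightarrow> real^'n \<Rightarrow> complex" where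
  "weak_pderiv \<Omega> i u = (SOME g. has_weak_pderiv \<Omega> i u g)"

definition H1_space :: "(real^'n::finite) set \<Rightarrow> (real^'n \<Rightarrow> complex) set" where
  "H1_space \<Omega> = {u. in_L2 (lebesgue_on \<Omega>) u \<and> (\<forall>i. \<exists>g. has_weak_pderiv \<Omega> i u g)}"

definition H2_space :: "(real^'n::finite) set \<Rightarrow> (real^'n \<Rightarrow> complex) set" where
  "H2_space \<Omega> = {u \<in> H1_space \<Omega>. \<forall>i. weak_pderiv \<Omega> i u \<in> H1_space \<Omega>}"

definition weak_grad ::
  "(real^'n::finite) set \<Rightarrow> (real^'n \<Rightarrow> complex) \<Rightarrow> real^'n \<Rightarrow> complex^'n" where
  "weak_grad \<Omega> u x = (\<chi> i. weak_pderiv \<Omega> i u x)"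

definition weak_hessian ::
  "(real^'n::finite) set \<Rightarrow> (real^'n \<Rightarrow> complex) \<Rightarrow> real^'n \<Rightarrow> complex^'n^'n" where
  "weak_hessian \<Omega> u x = (\<chi> i j. weak_pderiv \<Omega> j (weak_pderiv \<Omega> i u) x)"

definition weak_laplacian ::
  "(real^'n::finite) set \<Rightarrow> (real^'n \<Rightarrow> complex) \<Rightarrow> real^'n \<Rightarrow> complex" where
  "weak_laplacian \<Omega> u x = (\<Sum>i\<in>UNIV. weak_pderiv \<Omega> i (weak_pderiv \<Omega> i u) x)"

definition H1_inner ::
  "(real^'n::finite) set \<Rightarrow> (real^'n \<Rightarrow> complex) \<Rightarrow> (real^'n \<Rightarrow> complex) \<Rightarrow> complex" where
  "H1_inner \<Omega> u v =
     l2_inner (lebesgue_on \<Omega>) u v + l2_inner_vec (lebesgue_on \<Omega>) (weak_grad \<Omega> u) (weak_grad \<Omega> v)"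

definition H1_norm :: "(real^'n::finite) set \<Rightarrow> (real^'n \<Rightarrow> complex) \<Rightarrow> real" where
  "H1_norm \<Omega> u = sqrt (Re (H1_inner \<Omega> u u))"


section \<open>Surface measure and boundary traces\<close>

text \<open>
  Hausdorff measure of integer dimension \<open>s \<ge> 1\<close>, normalised so that it agrees with Lebesgue measure
  in dimension \<open>s\<close>. The outer measure is a metric outer measure, hence countably additive on Borel
  sets, so that \<^const>\<open>measure_of\<close> does not fall back to the null measure.
\<close>

definition hausdorff_content :: "real \<Rightarrow> nat \<Rightarrow> 'a::metric_space set \<Rightarrow> ennreal" where
  "hausdorff_content \<delta> s A =
     (INF C\<in>{C :: nat \<Rightarrow> 'a set. A \<subseteq> (\<Union>i. C i) \<and> (\<forall>i. bounded (C i) \<and> diameter (C i) \<le> \<delta>)}.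
        \<Sum>i. ennreal (unit_ball_vol (real s) / 2 ^ s * diameter (C i) ^ s))"

definition hausdorff_outer :: "nat \<Rightarrow> 'a::metric_space set \<Rightarrow> ennreal" where
  "hausdorff_outer s A = (SUP \<delta>\<in>{0<..}. hausdorff_content \<delta> s A)"

definition hausdorff_measure :: "nat \<Rightarrow> 'a::metric_space measure" where
  "hausdorff_measure s = measure_of UNIV (sets borel) (hausdorff_outer s)"

definition surface_measure :: "(real^'n::finite) set \<Rightarrow> (real^'n) measure" where
  "surface_measure \<Omega> = completion (restrict_space (hausdorff_measure (CARD('n) - 1)) (frontier \<Omega>))"

text \<open>
  The trace operator from \<open>H\<^sup>1(\<Omega>)\<close> to \<open>L\<^sup>2(\<partial>\<Omega>)\<close> is the continuous extension of the restriction map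
  \<open>\<phi> \<mapsto> \<phi>|\<^sub>\<partial>\<^sub>\<Omega>\<close> on functions that are smooth up to the boundary. On a bounded Lipschitz domain the
  relation below is the graph of this operator.
\<close>

definition has_trace ::
  "(real^'n::finite) set \<Rightarrow> (real^'n \<Rightarrow> complex) \<Rightarrow> (real^'n \<Rightarrow> complex) \<Rightarrow> bool" where
  "has_trace \<Omega> u g \<longleftrightarrow> in_L2 (surface_measure \<Omega>) g \<and>
     (\<exists>\<phi> :: nat \<Rightarrow> real^'n \<Rightarrow> complex. (\<forall>m. smooth (\<phi> m)) \<and>
        (\<lambda>m. H1_norm \<Omega> (\<lambda>x. \<phi> m x - u x)) \<longlonglongrightarrow> 0 \<and>
        (\<lambda>m. l2_norm (surface_measure \<Omega>) (\<lambda>x. \<phi> m x - g x)) \<longlonglongrightarrow> 0)"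

definition bdry_trace ::
  "(real^'n::finite) set \<Rightarrow> (real^'n \<Rightarrow> complex) \<Rightarrow> real^'n \<Rightarrow> complex" where
  "bdry_trace \<Omega> u = (SOME g. has_trace \<Omega> u g)"


section \<open>Domains\<close>

text \<open>
  Near every boundary point, \<open>\<Omega>\<close> is the region above the graph of a function of class \<open>P\<close> in some
  direction \<open>e\<close>; \<open>x - (x \<bullet> e) e\<close> is the projection of \<open>x\<close> to the hyperplane orthogonal to \<open>e\<close>.
\<close>

definition graph_boundary :: "((real^'n::finite \<Rightarrow> real) \<Rightarrow> bool) \<Rightarrow> (real^'n) set \<Rightarrow> bool" where
  "graph_boundary P \<Omega> \<longleftrightarrow>
     (\<forall>p\<in>frontier \<Omega>. \<exists>U e \<zeta>. open U \<and> p \<in> U \<and> norm e = 1 \<and> P \<zeta> \<and>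
        \<Omega> \<inter> U = {x \<in> U. \<zeta> (x - (x \<bullet> e) *\<^sub>R e) < x \<bullet> e})"

definition bounded_lipschitz_domain :: "(real^'n::finite) set \<Rightarrow> bool" where
  "bounded_lipschitz_domain \<Omega> \<longleftrightarrow> open \<Omega> \<and> connected \<Omega> \<and> \<Omega> \<noteq> {} \<and> bounded \<Omega> \<and>
     graph_boundary (\<lambda>\<zeta>. \<exists>L. L-lipschitz_on UNIV \<zeta>) \<Omega>"

definition smooth_boundary :: "(real^'n::finite) set \<Rightarrow> bool" where
  "smooth_boundary \<Omega> \<longleftrightarrow> graph_boundary smooth \<Omega>"

definition convex_polyhedral :: "(real^'n::finite) set \<Rightarrow> bool" where
  "convex_polyhedral \<Omega> \<longleftrightarrow> convex \<Omega> \<and> polytope (closure \<Omega>)"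

definition polygonal :: "(real^'n::finite) set \<Rightarrow> bool" where
  "polygonal \<Omega> \<longleftrightarrow> (\<exists>F. finite F \<and> frontier \<Omega> = (\<Union>(a, b)\<in>F. closed_segment a b))"

definition admissible_domain :: "(real^'n::finite) set \<Rightarrow> (real^'n) set \<Rightarrow> bool" where
  "admissible_domain \<Omega> \<Gamma>\<^sub>D \<longleftrightarrow> bounded_lipschitz_domain \<Omega> \<and>
     (smooth_boundary \<Omega> \<or> convex_polyhedral \<Omega> \<or>
      (CARD('n) = 2 \<and> \<Gamma>\<^sub>D = frontier \<Omega> \<and> polygonal \<Omega>))"


section \<open>The variational problem\<close>

definition ddot :: "'a::comm_semiring_1^'n::finite^'n \<Rightarrow> 'a^'n^'n \<Rightarrow> 'a" where
  "ddot A B = trace (transpose A ** B)"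

definition cmat :: "real^'n::finite^'n \<Rightarrow> complex^'n^'n" where
  "cmat A = (\<chi> i j. complex_of_real (A $ i $ j))"

definition outer :: "real^'n::finite \<Rightarrow> real^'n \<Rightarrow> real^'n^'n" where
  "outer v w = (\<chi> i j. v $ i * w $ j)"

definition V_space :: "(real^'n::finite) set \<Rightarrow> (real^'n) set \<Rightarrow> (real^'n \<Rightarrow> complex) set" where
  "V_space \<Omega> \<Gamma>\<^sub>D =
     {v \<in> H2_space \<Omega>. AE x in surface_measure \<Omega>. x \<in> \<Gamma>\<^sub>D \<longrightarrow> bdry_trace \<Omega> v x = 0}"

definition V_inner ::
  "real \<Rightarrow> (real^'n::finite) set \<Rightarrow> (real^'n \<Rightarrow> complex) \<Rightarrow> (real^'n \<Rightarrow> complex) \<Rightarrow> complex" where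
  "V_inner \<gamma> \<Omega> u v =
     complex_of_real (1 / \<gamma>) * l2_inner (lebesgue_on \<Omega>) (weak_laplacian \<Omega> u) (weak_laplacian \<Omega> v)
     + H1_inner \<Omega> u v"

definition V_norm :: "real \<Rightarrow> (real^'n::finite) set \<Rightarrow> (real^'n \<Rightarrow> complex) \<Rightarrow> real" where
  "V_norm \<gamma> \<Omega> u = sqrt (Re (V_inner \<gamma> \<Omega> u u))"

definition form_a ::
  "(real^'n::finite) set \<Rightarrow> (real^'n) set \<Rightarrow> real^'n^'n \<Rightarrow> real \<Rightarrow> real
    \<Rightarrow> (real^'n \<Rightarrow> complex) \<Rightarrow> (real^'n \<Rightarrow> complex) \<Rightarrow> complex" where
  "form_a \<Omega> \<Gamma>\<^sub>R A k \<theta> u v =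
     l2_inner (lebesgue_on \<Omega>) (\<lambda>x. ddot (cmat A) (weak_hessian \<Omega> u x)) (weak_laplacian \<Omega> v)
     + l2_inner_vec (lebesgue_on \<Omega>) (weak_grad \<Omega> u) (weak_grad \<Omega> v)
     - complex_of_real (k\<^sup>2) * l2_inner (lebesgue_on \<Omega>) u v
     - \<i> * complex_of_real \<theta> *
         l2_inner (restrict_space (surface_measure \<Omega>) \<Gamma>\<^sub>R) (bdry_trace \<Omega> u) (bdry_trace \<Omega> v)"

end

theory Submission
  imports Defs
begin

text \<open>
  Write \<open>\<gamma> A : D\<^sup>2u = \<Delta>u + (\<gamma> A - I) : D\<^sup>2u\<close> and let \<open>q = C\<^sub>R |\<gamma> A - I| < 1\<close>. By Young's inequality
  with weight \<open>1 / C\<^sub>R\<close> and the regularity estimate, the second summand perturbs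
  \<open>\<parallel>\<Delta>u\<parallel>\<^sup>2\<close> by at most \<open>q (\<parallel>\<Delta>u\<parallel>\<^sup>2 + \<parallel>\<Delta>u\<parallel> \<parallel>u\<parallel> + \<parallel>u\<parallel>\<^sup>2 / 2)\<close>, so half of \<open>(1 - q) \<parallel>\<Delta>u\<parallel>\<^sup>2\<close> survives after
  absorbing the mixed term. The boundary term is purely imaginary on the diagonal.
\<close>

section \<open>Square-integrable functions\<close>

text \<open>Domination by the sum of the two squares. Integrability must be secured before
  \<open>integral_mono\<close> and \<open>integral_Re\<close> apply, since a Bochner integral
  silently takes the value 0 on non-integrable functions.\<close>

lemma in_L2_integrable_mult_cnj:
  assumes "in_L2 M f" "in_L2 M g"
  shows "integrable M (\<lambda>x. f x * cnj (g x))"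
proof (rule Bochner_Integration.integrable_bound)
  show "integrable M (\<lambda>x. (norm (f x))\<^sup>2 + (norm (g x))\<^sup>2)"
    using assms by (simp add: in_L2_def)
  have [measurable]: "f \<in> borel_measurable M" "g \<in> borel_measurable M"
    using assms by (simp_all add: in_L2_def)
  have "(\<lambda>x. cnj (g x)) \<in> borel_measurable M"
    by (rule borel_measurable_continuous_on[OF continuous_on_cnj[OF continuous_on_id]]) simp
  then show "(\<lambda>x. f x * cnj (g x)) \<in> borel_measurable M"
    by simp
  have "norm (f x) * norm (g x) \<le> (norm (f x))\<^sup>2 + (norm (g x))\<^sup>2" for x
    using sum_squares_bound[of "norm (f x)" "norm (g x)"]
      mult_nonneg_nonneg[of "norm (f x)" "norm (g x)"] norm_ge_zero[of "f x"] norm_ge_zero[of "g x"]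
    by linarith
  then show "AE x in M. norm (f x * cnj (g x)) \<le> norm ((norm (f x))\<^sup>2 + (norm (g x))\<^sup>2)"
    by (simp add: norm_mult)
qed

lemma in_L2_add:
  assumes "in_L2 M f" "in_L2 M g"
  shows "in_L2 M (\<lambda>x. f x + g x)"
proof -
  have [measurable]: "f \<in> borel_measurable M" "g \<in> borel_measurable M"
    using assms by (simp_all add: in_L2_def)
  have "integrable M (\<lambda>x. (norm (f x + g x))\<^sup>2)"
  proof (rule Bochner_Integration.integrable_bound)
    show "integrable M (\<lambda>x. 2 * (norm (f x))\<^sup>2 + 2 * (norm (g x))\<^sup>2)"
      using assms by (simp add: in_L2_def)
    have "(norm (f x + g x))\<^sup>2 \<le> 2 * (norm (f x))\<^sup>2 + 2 * (norm (g x))\<^sup>2" for x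
    proof -
      have "(norm (f x + g x))\<^sup>2 \<le> (norm (f x) + norm (g x))\<^sup>2"
        by (intro power_mono norm_triangle_ineq norm_ge_zero)
      then show ?thesis
        using sum_squares_bound[of "norm (f x)" "norm (g x)"] by (simp add: power2_sum)
    qed
    then show "AE x in M. norm ((norm (f x + g x))\<^sup>2)
        \<le> norm (2 * (norm (f x))\<^sup>2 + 2 * (norm (g x))\<^sup>2)"
      by simp
  qed measurable
  then show ?thesis
    by (simp add: in_L2_def)
qed

lemma in_L2_cmult: "in_L2 M f \<Longrightarrow> in_L2 M (\<lambda>x. c * f x)"
  by (auto simp: in_L2_def norm_mult power_mult_distrib intro!: borel_measurable_times)

lemma in_L2_sum: "(\<And>i. i \<in> I \<Longrightarrow> in_L2 M (f i)) \<Longrightarrow> in_L2 M (\<lambda>x. \<Sum>i\<in>I. f i x)"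
proof (induction I rule: infinite_finite_induct)
  case (insert i I)
  then show ?case by (simp add: in_L2_add)
qed (simp_all add: in_L2_def)

lemma l2_norm_nonneg: "0 \<le> l2_norm M f"
  by (simp add: l2_norm_def)

lemma l2_norm_power2: "(l2_norm M f)\<^sup>2 = (\<integral>x. (norm (f x))\<^sup>2 \<partial>M)"
  by (simp add: l2_norm_def)

text \<open>The integrand is the real number \<open>(norm (f x))\<^sup>2\<close>, and integration
  commutes with \<open>complex_of_real\<close> even in the non-integrable case, where both sides are
  0. So it also covers the chosen boundary trace, whose inner product with itself is therefore
  real.\<close>

lemma l2_inner_self: "l2_inner M f f = complex_of_real ((l2_norm M f)\<^sup>2)"
proof -
  have "l2_inner M f f = (\<integral>x. complex_of_real ((norm (f x))\<^sup>2) \<partial>M)"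
    unfolding l2_inner_def by (simp only: complex_norm_square)
  then show ?thesis
    by (simp only: integral_complex_of_real l2_norm_power2)
qed

lemma l2_inner_vec_self_nonneg: "0 \<le> Re (l2_inner_vec M F F)"
  by (simp add: l2_inner_vec_def l2_inner_self sum_nonneg)


section \<open>The Frobenius product\<close>

lemma ddot_eq_sum: "ddot A B = (\<Sum>i\<in>UNIV. \<Sum>j\<in>UNIV. A $ i $ j * B $ i $ j)"
  unfolding ddot_def trace_def matrix_matrix_mult_def transpose_def
  by (simp, rule sum.swap)

lemma norm_matrix_power2:
  fixes B :: "'a::real_normed_vector^'n::finite^'m::finite"
  shows "(norm B)\<^sup>2 = (\<Sum>i\<in>UNIV. \<Sum>j\<in>UNIV. (norm (B $ i $ j))\<^sup>2)"
  by (simp add: norm_vec_def L2_set_def sum_nonneg)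

text \<open>Cauchy-Schwarz twice, first inside each row and then across the rows, because the norm
  of a matrix is the nested Euclidean norm.\<close>

lemma norm_ddot_le:
  fixes A B :: "'a::{real_normed_algebra,comm_semiring_1}^'n::finite^'n"
  shows "norm (ddot A B) \<le> norm A * norm B"
proof -
  have "norm (ddot A B) \<le> (\<Sum>i\<in>UNIV. \<Sum>j\<in>UNIV. norm (A $ i $ j) * norm (B $ i $ j))"
    unfolding ddot_eq_sum by (intro sum_norm_le norm_mult_ineq)
  also have "\<dots> \<le> (\<Sum>i\<in>UNIV. norm (A $ i) * norm (B $ i))"
  proof (rule sum_mono)
    show "(\<Sum>j\<in>UNIV. norm (A $ i $ j) * norm (B $ i $ j)) \<le> norm (A $ i) * norm (B $ i)" for i
      unfolding norm_vec_def[of "A $ i"] norm_vec_def[of "B $ i"]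
      by (rule order_trans[OF _ L2_set_mult_ineq]) simp
  qed
  also have "\<dots> \<le> norm A * norm B"
    unfolding norm_vec_def[of A] norm_vec_def[of B]
    by (rule order_trans[OF _ L2_set_mult_ineq]) simp
  finally show ?thesis .
qed

lemma norm_cmat: "norm (cmat A) = norm A"
  by (simp add: cmat_def norm_vec_def)

text \<open>Contraction with the identity yields the trace. This isolates the Laplacian in the
  scaled operator and leaves a perturbation controlled by the Cordes quantity.\<close>

lemma ddot_cmat_diff_mat_1:
  fixes A :: "real^'n::finite^'n"
  shows "ddot (cmat (c *\<^sub>R A - mat 1)) B = complex_of_real c * ddot (cmat A) B - trace B"
proof -
  have "(\<Sum>j\<in>UNIV. complex_of_real ((mat 1 :: real^'n^'n) $ i $ j) * B $ i $ j) = B $ i $ i" for i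
    by (simp add: mat_def if_distrib[of complex_of_real] if_distrib[of "\<lambda>t. t * _"] cong: if_cong)
  then show ?thesis
    by (simp add: ddot_eq_sum cmat_def trace_def left_diff_distrib sum_subtractf sum_distrib_left
        mult.assoc)
qed

text \<open>Cauchy-Schwarz on the perturbation, then Young's inequality. The weight \<open>C\<close>
  stays free here; it becomes the regularity constant at the end.\<close>

lemma cordes_pointwise:
  fixes A :: "real^'n::finite^'n" and B :: "complex^'n^'n"
  assumes "C > 0"
  shows "\<gamma> * Re (ddot (cmat A) B * cnj (trace B))
    \<ge> (norm (trace B))\<^sup>2
      - norm (\<gamma> *\<^sub>R A - mat 1) * ((norm B)\<^sup>2 / (2 * C) + C * (norm (trace B))\<^sup>2 / 2)"
proof -
  define \<epsilon> where "\<epsilon> = norm (\<gamma> *\<^sub>R A - mat 1)"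
  define T where "T = trace B"
  define P where "P = ddot (cmat (\<gamma> *\<^sub>R A - mat 1)) B"
  have split: "complex_of_real \<gamma> * (ddot (cmat A) B * cnj T) = T * cnj T + P * cnj T"
    by (simp add: P_def T_def ddot_cmat_diff_mat_1 algebra_simps)
  have "\<gamma> * Re (ddot (cmat A) B * cnj T) = Re (complex_of_real \<gamma> * (ddot (cmat A) B * cnj T))"
    by simp
  also have "\<dots> = (norm T)\<^sup>2 + Re (P * cnj T)"
    unfolding split complex_norm_square[symmetric] by simp
  finally have eq: "\<gamma> * Re (ddot (cmat A) B * cnj T) = (norm T)\<^sup>2 + Re (P * cnj T)" .
  have "norm P \<le> \<epsilon> * norm B"
    unfolding P_def \<epsilon>_def by (rule order_trans[OF norm_ddot_le]) (simp add: norm_cmat)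
  then have "norm (P * cnj T) \<le> \<epsilon> * norm B * norm T"
    by (simp add: norm_mult mult_right_mono)
  moreover have "\<bar>Re (P * cnj T)\<bar> \<le> norm (P * cnj T)"
    by (rule abs_Re_le_cmod)
  moreover have "\<epsilon> * (norm B * norm T) \<le> \<epsilon> * ((norm B)\<^sup>2 / (2 * C) + C * (norm T)\<^sup>2 / 2)"
  proof (rule mult_left_mono)
    \<comment> \<open>Young's inequality with weight \<open>C\<close>, as a completed
      square.\<close>
    have "0 \<le> (norm B - C * norm T)\<^sup>2 / (2 * C)"
      using assms by simp
    also have "\<dots> = (norm B)\<^sup>2 / (2 * C) + C * (norm T)\<^sup>2 / 2 - norm B * norm T"
      using assms by (simp add: power2_diff field_simps power2_eq_square)
    finally show "norm B * norm T \<le> (norm B)\<^sup>2 / (2 * C) + C * (norm T)\<^sup>2 / 2"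
      by simp
  qed (simp add: \<epsilon>_def)
  ultimately show ?thesis
    using eq unfolding T_def[symmetric] \<epsilon>_def[symmetric] by (simp add: mult.assoc)
qed


section \<open>Second weak derivatives\<close>

text \<open>Square integrability is part of \<open>has_weak_pderiv\<close>, so the representative
  picked by \<open>SOME\<close> inherits it.\<close>

lemma H1_space_weak_pderiv_in_L2:
  assumes "u \<in> H1_space \<Omega>"
  shows "in_L2 (lebesgue_on \<Omega>) (weak_pderiv \<Omega> i u)"
proof -
  have "has_weak_pderiv \<Omega> i u (weak_pderiv \<Omega> i u)"
    unfolding weak_pderiv_def using assms
    by (intro someI_ex[of "has_weak_pderiv \<Omega> i u"]) (simp add: H1_space_def)
  then show ?thesis
    by (simp add: has_weak_pderiv_def)
qed

lemma H2_space_weak_hessian_in_L2: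
  assumes "u \<in> H2_space \<Omega>"
  shows "in_L2 (lebesgue_on \<Omega>) (\<lambda>x. weak_hessian \<Omega> u x $ i $ j)"
  using assms H1_space_weak_pderiv_in_L2[of "weak_pderiv \<Omega> i u" \<Omega> j]
  by (simp add: weak_hessian_def H2_space_def)

text \<open>Both sides use the same chosen representatives, so equality holds at every point and the
  pointwise estimate transfers without null sets.\<close>

lemma trace_weak_hessian: "trace (weak_hessian \<Omega> u x) = weak_laplacian \<Omega> u x"
  by (simp add: trace_def weak_hessian_def weak_laplacian_def)

lemma cordes_integrated:
  fixes A :: "real^'n::finite^'n"
  assumes u: "u \<in> H2_space \<Omega>" and C: "C > 0"
  shows "\<gamma> * Re (l2_inner (lebesgue_on \<Omega>)
        (\<lambda>x. ddot (cmat A) (weak_hessian \<Omega> u x)) (weak_laplacian \<Omega> u))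
    \<ge> (l2_norm (lebesgue_on \<Omega>) (weak_laplacian \<Omega> u))\<^sup>2
      - norm (\<gamma> *\<^sub>R A - mat 1) *
        ((l2_norm (lebesgue_on \<Omega>) (weak_hessian \<Omega> u))\<^sup>2 / (2 * C)
          + C * (l2_norm (lebesgue_on \<Omega>) (weak_laplacian \<Omega> u))\<^sup>2 / 2)"
proof -
  let ?M = "lebesgue_on \<Omega>" and ?H = "weak_hessian \<Omega> u" and ?L = "weak_laplacian \<Omega> u"
  let ?\<epsilon> = "norm (\<gamma> *\<^sub>R A - mat 1)" and ?D = "\<lambda>x. ddot (cmat A) (weak_hessian \<Omega> u x)"
  note H = H2_space_weak_hessian_in_L2[OF u]
  have L: "in_L2 ?M ?L"
    unfolding trace_weak_hessian[symmetric] trace_def by (intro in_L2_sum H)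
  have D: "in_L2 ?M ?D"
    unfolding ddot_eq_sum by (intro in_L2_sum in_L2_cmult H)
  have iH: "integrable ?M (\<lambda>x. (norm (?H x))\<^sup>2)"
    unfolding norm_matrix_power2 using H by (simp add: in_L2_def)
  have iL: "integrable ?M (\<lambda>x. (norm (?L x))\<^sup>2)"
    using L by (simp add: in_L2_def)
  note iDL = in_L2_integrable_mult_cnj[OF D L]
  have "(l2_norm ?M ?L)\<^sup>2
      - ?\<epsilon> * ((l2_norm ?M ?H)\<^sup>2 / (2 * C) + C * (l2_norm ?M ?L)\<^sup>2 / 2)
    = (\<integral>x. (norm (?L x))\<^sup>2
      - ?\<epsilon> * ((norm (?H x))\<^sup>2 / (2 * C) + C * (norm (?L x))\<^sup>2 / 2) \<partial>?M)"
    unfolding l2_norm_power2 using iH iL by simp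
  also have "\<dots> \<le> (\<integral>x. \<gamma> * Re (?D x * cnj (?L x)) \<partial>?M)"
  proof (rule integral_mono)
    show "integrable ?M (\<lambda>x. (norm (?L x))\<^sup>2
        - ?\<epsilon> * ((norm (?H x))\<^sup>2 / (2 * C) + C * (norm (?L x))\<^sup>2 / 2))"
      using iH iL by simp
    show "integrable ?M (\<lambda>x. \<gamma> * Re (?D x * cnj (?L x)))"
      by (intro integrable_mult_right integrable_Re iDL)
    show "(norm (?L x))\<^sup>2 - ?\<epsilon> * ((norm (?H x))\<^sup>2 / (2 * C) + C * (norm (?L x))\<^sup>2 / 2)
        \<le> \<gamma> * Re (?D x * cnj (?L x))" for x
      using cordes_pointwise[OF C, of "?H x" \<gamma> A] by (simp only: trace_weak_hessian)
  qed
  also have "\<dots> = \<gamma> * Re (l2_inner ?M ?D ?L)"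
    unfolding l2_inner_def integral_mult_right_zero integral_Re[OF iDL] ..
  finally show ?thesis .
qed

section \<open>Norm and form on the diagonal, and the final estimate\<close>

lemma V_norm_power2:
  assumes "\<gamma> > 0"
  shows "(V_norm \<gamma> \<Omega> u)\<^sup>2 = (l2_norm (lebesgue_on \<Omega>) (weak_laplacian \<Omega> u))\<^sup>2 / \<gamma>
    + (l2_norm (lebesgue_on \<Omega>) u)\<^sup>2
    + Re (l2_inner_vec (lebesgue_on \<Omega>) (weak_grad \<Omega> u) (weak_grad \<Omega> u))"
  \<comment> \<open>Positivity of \<gamma> and of the gradient term makes the radicand nonnegative,
    so \<open>sqrt\<close> cancels against the square.\<close>
  using assms l2_inner_vec_self_nonneg[of "lebesgue_on \<Omega>" "weak_grad \<Omega> u"]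
  by (simp add: V_norm_def V_inner_def H1_inner_def l2_inner_self del: of_real_power)

text \<open>By \<open>l2_inner_self\<close> the boundary inner product is real; its factor
  \<open>\<i> * \<theta>\<close> makes that term purely imaginary.\<close>

lemma Re_form_a_self:
  "Re (form_a \<Omega> \<Gamma> A k \<theta> u u) =
    Re (l2_inner (lebesgue_on \<Omega>) (\<lambda>x. ddot (cmat A) (weak_hessian \<Omega> u x)) (weak_laplacian \<Omega> u))
    + Re (l2_inner_vec (lebesgue_on \<Omega>) (weak_grad \<Omega> u) (weak_grad \<Omega> u))
    - k\<^sup>2 * (l2_norm (lebesgue_on \<Omega>) u)\<^sup>2"
  by (simp add: form_a_def l2_inner_self del: of_real_power)

text \<open>The difference of the two sides is the perfect square
  \<open>((1 - q) * x - q * y)\<^sup>2 / (2 * (1 - q))\<close>: half of the \<open>x\<^sup>2\<close>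
  term pays for the mixed term.\<close>

lemma absorb_mixed_term:
  fixes q x y :: real
  assumes "q < 1"
  shows "(1 - q) * x\<^sup>2 - q * (x * y) - q * y\<^sup>2 / 2
    \<ge> (1 - q) / 2 * x\<^sup>2 - (q\<^sup>2 / (2 * (1 - q)) + q / 2) * y\<^sup>2"
proof -
  have "0 \<le> ((1 - q) * x - q * y)\<^sup>2 / (2 * (1 - q))"
    using assms by simp
  also have "\<dots> = (1 - q) / 2 * x\<^sup>2 - q * (x * y) + q\<^sup>2 / (2 * (1 - q)) * y\<^sup>2"
  proof -
    have "(p * x - q * y)\<^sup>2 / (2 * p) = p / 2 * x\<^sup>2 - q * (x * y) + q\<^sup>2 / (2 * p) * y\<^sup>2"
      if "p > 0" for p :: real
      using that by (simp add: power2_diff field_simps power2_eq_square)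
    from this[of "1 - q"] show ?thesis
      using assms by simp
  qed
  finally show ?thesis
    by (simp add: algebra_simps add_divide_distrib diff_divide_distrib)
qed

theorem lemma5:
  fixes \<Omega> \<Gamma>\<^sub>D \<Gamma>\<^sub>R :: "(real^'n::finite) set"
    and \<alpha> \<beta> k \<theta> \<gamma> C\<^sub>R :: real
    and n :: "real^'n"
    and A :: "real^'n^'n"
  assumes dim: "CARD('n) = 2 \<or> CARD('n) = 3"
    and domain: "admissible_domain \<Omega> \<Gamma>\<^sub>D"
    and partition: "\<Gamma>\<^sub>D \<union> \<Gamma>\<^sub>R = frontier \<Omega>" "\<Gamma>\<^sub>D \<inter> \<Gamma>\<^sub>R = {}"
    and measurable: "\<Gamma>\<^sub>D \<in> sets (surface_measure \<Omega>)" "\<Gamma>\<^sub>R \<in> sets (surface_measure \<Omega>)"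
    and params: "\<alpha> > 0" "k > 0" "\<theta> > 0" "norm n = 1"
    and A: "A = \<alpha> *\<^sub>R mat 1 + \<beta> *\<^sub>R outer n n"
    and \<gamma>: "\<gamma> = trace A / (norm A)\<^sup>2" "\<gamma> > 0"
    and C\<^sub>R: "C\<^sub>R \<ge> 1"
    and regularity: "\<And>u. u \<in> V_space \<Omega> \<Gamma>\<^sub>D \<Longrightarrow>
           l2_norm (lebesgue_on \<Omega>) (weak_hessian \<Omega> u)
             \<le> C\<^sub>R * (l2_norm (lebesgue_on \<Omega>) (weak_laplacian \<Omega> u) + l2_norm (lebesgue_on \<Omega>) u)"
    and cordes: "C\<^sub>R * norm (\<gamma> *\<^sub>R A - mat 1) < 1"
  shows "\<exists>C\<^sub>V > 0. \<exists>C\<^sub>L > 0. \<forall>u \<in> V_space \<Omega> \<Gamma>\<^sub>D.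
           Re (form_a \<Omega> \<Gamma>\<^sub>R A k \<theta> u u)
             \<ge> C\<^sub>V * (V_norm \<gamma> \<Omega> u)\<^sup>2 - C\<^sub>L * (l2_norm (lebesgue_on \<Omega>) u)\<^sup>2"
proof -
  define \<epsilon> where "\<epsilon> = norm (\<gamma> *\<^sub>R A - mat 1)"
  define q where "q = C\<^sub>R * \<epsilon>"
  define K where "K = q\<^sup>2 / (2 * (1 - q)) + q / 2"
  have q: "0 \<le> q" "q < 1"
    using C\<^sub>R cordes by (simp_all add: q_def \<epsilon>_def)
  then have K: "0 \<le> K"
    by (simp add: K_def)
  \<comment> \<open>The coefficient that survives absorption. It is free of \<gamma>, because
    division by \<gamma> matches the weight of the Laplacian in the \<open>V\<close> norm.\<close>
  define C\<^sub>V where "C\<^sub>V = (1 - q) / 2"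
  \<comment> \<open>The summands compensate, in order, the \<open>L2\<close> part of the
    \<open>V\<close> norm, the remainder of the absorption divided by \<gamma>, and the Helmholtz
    term.\<close>
  define C\<^sub>L where "C\<^sub>L = C\<^sub>V + K / \<gamma> + k\<^sup>2"
  have C\<^sub>V: "0 < C\<^sub>V" "C\<^sub>V \<le> 1"
    using q by (simp_all add: C\<^sub>V_def)
  have "0 < C\<^sub>L"
    using C\<^sub>V K \<gamma>(2) by (simp add: C\<^sub>L_def add_pos_nonneg)
  moreover have "C\<^sub>V * (V_norm \<gamma> \<Omega> u)\<^sup>2 - C\<^sub>L * (l2_norm (lebesgue_on \<Omega>) u)\<^sup>2
      \<le> Re (form_a \<Omega> \<Gamma>\<^sub>R A k \<theta> u u)" if u: "u \<in> V_space \<Omega> \<Gamma>\<^sub>D" for u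
  proof -
    define x where "x = l2_norm (lebesgue_on \<Omega>) (weak_laplacian \<Omega> u)"
    define y where "y = l2_norm (lebesgue_on \<Omega>) u"
    define N where "N = l2_norm (lebesgue_on \<Omega>) (weak_hessian \<Omega> u)"
    define g where "g = Re (l2_inner_vec (lebesgue_on \<Omega>) (weak_grad \<Omega> u) (weak_grad \<Omega> u))"
    define R where "R = Re (l2_inner (lebesgue_on \<Omega>)
      (\<lambda>x. ddot (cmat A) (weak_hessian \<Omega> u x)) (weak_laplacian \<Omega> u))"
    have "u \<in> H2_space \<Omega>"
      using u by (simp add: V_space_def)
    then have R: "x\<^sup>2 - \<epsilon> * (N\<^sup>2 / (2 * C\<^sub>R) + C\<^sub>R * x\<^sup>2 / 2) \<le> \<gamma> * R"
      unfolding x_def N_def \<epsilon>_def R_def using C\<^sub>R by (intro cordes_integrated) auto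
    have "N\<^sup>2 \<le> (C\<^sub>R * (x + y))\<^sup>2"
      using regularity[OF u] unfolding N_def x_def y_def by (intro power_mono l2_norm_nonneg)
    \<comment> \<open>The Young weight \<open>C\<^sub>R\<close> pays off: one factor of the squared
      regularity constant cancels, so both Young terms carry exactly
      \<open>\<epsilon> * C\<^sub>R = q\<close>.\<close>
    then have "N\<^sup>2 / (2 * C\<^sub>R) \<le> (C\<^sub>R * (x + y))\<^sup>2 / (2 * C\<^sub>R)"
      using C\<^sub>R by (intro divide_right_mono) auto
    also have "\<dots> = C\<^sub>R * (x + y)\<^sup>2 / 2"
      using C\<^sub>R by (simp add: power_mult_distrib power2_eq_square[of C\<^sub>R])
    finally have "\<epsilon> * (N\<^sup>2 / (2 * C\<^sub>R) + C\<^sub>R * x\<^sup>2 / 2) \<le> \<epsilon> * (C\<^sub>R * (x + y)\<^sup>2 / 2 + C\<^sub>R * x\<^sup>2 / 2)"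
      by (intro mult_left_mono add_right_mono) (simp_all add: \<epsilon>_def)
    also have "\<dots> = q * (x\<^sup>2 + x * y + y\<^sup>2 / 2)"
      by (simp add: q_def power2_sum field_simps)
    finally have "(1 - q) * x\<^sup>2 - q * (x * y) - q * y\<^sup>2 / 2 \<le> \<gamma> * R"
      using R by (simp add: algebra_simps)
    with absorb_mixed_term[OF q(2), of x y] have "C\<^sub>V * x\<^sup>2 - K * y\<^sup>2 \<le> \<gamma> * R"
      unfolding C\<^sub>V_def K_def by linarith
    then have "(C\<^sub>V * x\<^sup>2 - K * y\<^sup>2) / \<gamma> \<le> R"
      using \<gamma>(2) by (simp add: divide_le_eq mult.commute)
    \<comment> \<open>The form contains the full gradient term, which covers its share in the
      \<open>V\<close> norm since \<open>C\<^sub>V \<le> 1\<close>.\<close>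
    moreover have "C\<^sub>V * g \<le> g"
      using C\<^sub>V l2_inner_vec_self_nonneg[of "lebesgue_on \<Omega>" "weak_grad \<Omega> u"]
      unfolding g_def by (intro mult_left_le_one_le) auto
    ultimately show ?thesis
      unfolding V_norm_power2[OF \<gamma>(2)] Re_form_a_self x_def[symmetric] y_def[symmetric]
        g_def[symmetric] R_def[symmetric] C\<^sub>L_def
      by (simp add: algebra_simps diff_divide_distrib)
  qed
  ultimately show ?thesis
    using C\<^sub>V(1) by blast
qed

end
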